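(* Let $X\subset\mathbb{C}$ be a continuum. Then, for any point $x\in X$, $F_x^*$ consists of the points $y\in X$ such that every simple closed curve $\gamma$ separating $x$ from $y$ must intersect $\partial X$ at infinitely many points. Equivalently, $X\setminus F_x^*$ consists of the points $z\in X$ which may be separated from $x$ by a simple closed curve $\gamma$ such that $\gamma\cap\partial X$ is a finite set (possibly empty).
   Context: A continuum is a nonempty compact connected metric space (possibly a single point). $X^o$ and $\partial X$ denote the interior and boundary of $X$ in $\mathbb{C}$. A simple closed curve $\gamma\subset\mathbb{C}$ separates $x$ from $y$ if $x$ and $y$ belong to different components of $\mathbb{C}\setminus\gamma$. A point $x\in\partial X$ is separated from a point $y\in\partial X$ by a subset $C\subset X$ if there is a separation $\partial X\setminus C=A\cup B$, i.e. a decomposition with $\overline{A}\cap B=A\cap\overline{B}=\emptyset$, such that $x\in A$ and $y\in B$. The modified pseudo-fiber $E_x^*$ of $X$ at $x$ is: $E_x^*=\{x\}$ if $x\in X^o$; and, if $x\in\partial X$, $E_x^*$ is the set of points $y\in\partial X$ that cannot be separated from $x$ by any finite set $C\subset\partial X$. The modified fiber $F_x^*$ of $X$ at $x$ is the connected component of $E_x^*$ containing $x$. *)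

theory Defs
  imports "HOL-Analysis.Analysis"
begin

definition plane_continuum :: "complex set \<Rightarrow> bool" where
  "plane_continuum X \<longleftrightarrow> X \<noteq> {} \<and> compact X \<and> connected X"

definition simple_closed_curve :: "complex set \<Rightarrow> bool" where
  "simple_closed_curve \<gamma> \<longleftrightarrow>
     (\<exists>g. simple_path g \<and> pathfinish g = pathstart g \<and> path_image g = \<gamma>)"

text \<open>In particular, neither point lies on the curve.\<close>

definition curve_separates :: "complex set \<Rightarrow> complex \<Rightarrow> complex \<Rightarrow> bool" where
  "curve_separates \<gamma> x y \<longleftrightarrow>
     (\<exists>U \<in> components (- \<gamma>). \<exists>V \<in> components (- \<gamma>). U \<noteq> V \<and> x \<in> U \<and> y \<in> V)"

text \<open>In particular, neither \<open>x\<close> nor \<open>y\<close> lies in \<open>C\<close>.\<close>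

definition separated_by :: "complex set \<Rightarrow> complex set \<Rightarrow> complex \<Rightarrow> complex \<Rightarrow> bool" where
  "separated_by X C x y \<longleftrightarrow>
     (\<exists>A B. frontier X - C = A \<union> B \<and> closure A \<inter> B = {} \<and> A \<inter> closure B = {} \<and>
            x \<in> A \<and> y \<in> B)"

text \<open>The next two notions are only meaningful for \<open>x \<in> X\<close>, where (for closed \<open>X\<close>)
  \<open>x \<notin> interior X\<close> means \<open>x \<in> frontier X\<close>.\<close>

definition modified_pseudo_fiber :: "complex set \<Rightarrow> complex \<Rightarrow> complex set" where
  "modified_pseudo_fiber X x =
     (if x \<in> interior X then {x}
      else {y \<in> frontier X. \<not> (\<exists>C. finite C \<and> C \<subseteq> frontier X \<and> separated_by X C x y)})"

definition modified_fiber :: "complex set \<Rightarrow> complex \<Rightarrow> complex set" where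
  "modified_fiber X x = connected_component_set (modified_pseudo_fiber X x) x"

end

theory Submission
  imports Defs "HOL-Complex_Analysis.Contour_Integration"
begin

text \<open>If a simple closed curve meets the boundary of \<open>X\<close> in a finite set and
  separates \<open>x\<close> from \<open>y\<close>, then its inside and outside cut the rest of
  the boundary into two separated parts, so boundary points \<open>x\<close> and
  \<open>y\<close> do not share a pseudo-fiber
  (\<open>separating_curve_imp_separated_by\<close>). For the converse, two facts are needed.

  The first is that the pseudo-fiber of a boundary point is connected, and hence equal to the
  fiber (\<open>connected_modified_pseudo_fiber\<close>): by compactness, a splitting of the
  pseudo-fiber could be realized by a finite set of boundary points, which by definition cannot
  separate its points.

  The second is that a separation of the boundary by a finite set \<open>C\<close> can be
  realized by a simple closed curve in \<open>T\<close>, the complement of the boundary together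
  with \<open>C\<close>. The points equally far from the two closed parts yield a compact set
  \<open>S\<close> in \<open>T\<close> that separates \<open>x\<close> from \<open>y\<close>
  (\<open>separated_imp_compact_separator\<close>). The set \<open>S\<close> may be very
  irregular, so no curve can be read off from it. By Borsuk's criterion
  (\<open>logarithm_iff_not_separated\<close>), \<open>S\<close> separates \<open>x\<close> from
  \<open>y\<close> because the function \<open>(z - x) / (z - y)\<close> has no continuous
  logarithm on \<open>S\<close>. There are two cases.

  If continuation along some closed path in \<open>T\<close> changes the value of the logarithm,
  then a shortest part of this path with this property, made injective in the covering on which
  the logarithm lives, is a simple closed curve that separates \<open>x\<close> from
  \<open>y\<close> (\<open>nontrivial_log_cover_path_imp_separating_curve\<close>).

  Otherwise continuation along paths defines a logarithm on \<open>T\<close> that is continuous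
  except perhaps at the points of \<open>C\<close>, where \<open>S\<close> may accumulate
  through regions from which no path in \<open>T\<close> leads to the point. By an argument in
  the manner of Koenig's lemma, the part of \<open>S\<close> that lies in such regions near a
  point of \<open>C\<close> can be cut off from the rest
  (\<open>not_detachable_imp_accessible\<close>). Changing the logarithm there to the branch
  around that point makes it continuous on \<open>S\<close>, which contradicts Borsuk's
  criterion (\<open>univalent_log_cover_imp_not_separated\<close>).\<close>

section \<open>Logarithms and separation of the plane\<close>

text \<open>Two values of the logarithm of the same number differ by an integer multiple of
  \<open>2 * pi * \<i>\<close>, so the difference of two continuous logarithms has a discrete
  range.\<close>

lemma logarithms_differ_by_constant:
  fixes g h :: "'a::topological_space \<Rightarrow> complex"
  assumes "connected S" "continuous_on S g" "continuous_on S h"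
    and eq: "\<And>z. z \<in> S \<Longrightarrow> exp (g z) = exp (h z)"
  obtains k where "\<And>z. z \<in> S \<Longrightarrow> g z = h z + k"
proof -
  have "(\<lambda>z. g z - h z) constant_on S"
  proof (rule continuous_discrete_range_constant [OF \<open>connected S\<close>])
    show "continuous_on S (\<lambda>z. g z - h z)"
      using assms by (intro continuous_intros)
    show "\<exists>e>0. \<forall>y. y \<in> S \<and> g y - h y \<noteq> g x - h x \<longrightarrow> e \<le> norm (g y - h y - (g x - h x))"
      if "x \<in> S" for x
    proof (intro exI [of _ "2*pi"] conjI allI impI)
      fix y assume y: "y \<in> S \<and> g y - h y \<noteq> g x - h x"
      have "exp (g y - h y) = exp (g x - h x)"
        using eq that y by (simp add: exp_diff)
      then show "2 * pi \<le> norm (g y - h y - (g x - h x))"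
        using y norm_exp_imaginary
        by (metis exp_complex_eqI linorder_not_le minus_complex.simps(2) abs_Im_le_cmod order_le_less_trans)
    qed simp
  qed
  then obtain k where "\<And>z. z \<in> S \<Longrightarrow> g z - h z = k"
    by (auto simp: constant_on_def)
  then show thesis
    by (intro that [of k]) (metis add_diff_cancel_left' diff_add_cancel add.commute)
qed

text \<open>The planar case of Borsuk's separation criterion: the directions in which a point of
  \<open>S\<close> sees \<open>a\<close> and \<open>b\<close> are homotopic maps into the unit
  circle exactly if \<open>a\<close> and \<open>b\<close> can be joined off \<open>S\<close>,
  and homotopic circle-valued maps are those whose quotient has a continuous argument. Adding
  the real logarithm of the modulus turns the argument into a logarithm.\<close>

lemma logarithm_iff_not_separated:
  fixes a b :: complex
  assumes "compact S" "a \<notin> S" "b \<notin> S"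
  shows "(\<exists>g. continuous_on S g \<and> (\<forall>z\<in>S. exp (g z) = (z - a) / (z - b)))
         \<longleftrightarrow> connected_component (- S) a b"
    (is "?log \<longleftrightarrow> _")
proof -
  define u where "u = (\<lambda>(c::complex) z. (z - c) /\<^sub>R norm (z - c))"
  have u_cont: "continuous_on S (u c)" and u_sphere: "u c \<in> S \<rightarrow> sphere 0 1"
    if "c \<notin> S" for c
    using that unfolding u_def by (force intro!: continuous_intros simp: divide_simps)+
  have unit: "v / w = of_real (norm (v / w)) * ((v /\<^sub>R norm v) / (w /\<^sub>R norm w))"
    if "v \<noteq> 0" "w \<noteq> 0" for v w :: complex
    using that by (simp add: norm_divide scaleR_conv_of_real field_simps)
  have polar: "(z - a) / (z - b) = of_real (norm ((z - a) / (z - b))) * (u a z / u b z)"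
    if "z \<in> S" for z
    unfolding u_def by (rule unit) (use that assms in auto)
  have "connected_component (- S) a b \<longleftrightarrow> homotopic_with_canon (\<lambda>x. True) S (sphere 0 1) (u a) (u b)"
    unfolding u_def using Borsuk_maps_homotopic_in_connected_component_eq [OF assms] by simp
  also have "\<dots> \<longleftrightarrow> (\<exists>c. homotopic_with_canon (\<lambda>h. True) S (sphere 0 1) (\<lambda>z. u a z / u b z) (\<lambda>x. c))"
    by (subst homotopic_circlemaps_divide) (use assms u_cont u_sphere in auto)
  also have "\<dots> \<longleftrightarrow> (\<exists>g. continuous_on S g \<and> (\<forall>z\<in>S. u a z / u b z = exp (\<i> * complex_of_real (g z))))"
    by (rule inessential_eq_continuous_logarithm_circle)
  also have "\<dots> \<longleftrightarrow> ?log"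
  proof
    assume "\<exists>g. continuous_on S g \<and> (\<forall>z\<in>S. u a z / u b z = exp (\<i> * complex_of_real (g z)))"
    then obtain g where g: "continuous_on S g"
      "\<And>z. z \<in> S \<Longrightarrow> u a z / u b z = exp (\<i> * complex_of_real (g z))" by blast
    have "continuous_on S (\<lambda>z. of_real (ln (norm ((z - a) / (z - b)))) + \<i> * complex_of_real (g z))"
      using assms g by (intro continuous_intros) auto
    moreover have "exp (of_real (ln (norm ((z - a) / (z - b)))) + \<i> * complex_of_real (g z)) = (z - a) / (z - b)"
      if "z \<in> S" for z
    proof -
      have "0 < norm ((z - a) / (z - b))" using that assms by auto
      then show ?thesis
        unfolding exp_add g(2) [OF that, symmetric] exp_of_real
        using polar [OF that] by simp
    qed
    ultimately show ?log by (intro exI conjI ballI)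
  next
    assume ?log
    then obtain g where g: "continuous_on S g" "\<And>z. z \<in> S \<Longrightarrow> exp (g z) = (z - a) / (z - b)"
      by blast
    have "u a z / u b z = exp (\<i> * complex_of_real (Im (g z)))" if "z \<in> S" for z
    proof -
      have "norm ((z - a) / (z - b)) \<noteq> 0" using that assms by auto
      moreover have "exp (g z) = of_real (norm (exp (g z))) * exp (\<i> * complex_of_real (Im (g z)))"
        by (metis complex_eq exp_add norm_exp_eq_Re exp_of_real)
      ultimately show ?thesis
        using polar [OF that] g(2) [OF that] by (metis mult_cancel_left of_real_eq_0_iff)
    qed
    then show "\<exists>g. continuous_on S g \<and> (\<forall>z\<in>S. u a z / u b z = exp (\<i> * complex_of_real (g z)))"
      using g(1) by (intro exI [of _ "\<lambda>z. Im (g z)"]) (auto intro: continuous_intros)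
  qed
  finally show ?thesis by blast
qed

section \<open>Closed paths that change the logarithm\<close>

lemma curve_separatesI:
  assumes "a \<notin> \<gamma>" "b \<notin> \<gamma>" "\<not> connected_component (- \<gamma>) a b"
  shows "curve_separates \<gamma> a b"
  unfolding curve_separates_def using assms
  by (metis ComplI componentsI connected_component_eq_eq connected_component_refl_eq mem_Collect_eq)

text \<open>The points of \<open>T\<close> together with a chosen value of the logarithm of
  \<open>(z - a) / (z - b)\<close>: the pullback to \<open>T\<close> of the covering of the
  punctured plane by the exponential function. With division by zero yielding zero, there is no
  point above \<open>a\<close> or \<open>b\<close> when these are distinct.\<close>

definition log_cover :: "complex set \<Rightarrow> complex \<Rightarrow> complex \<Rightarrow> (complex \<times> complex) set" where
  "log_cover T a b = {(z, w). z \<in> T \<and> exp w = (z - a) / (z - b)}"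

text \<open>A path in the covering that returns to the same point of \<open>T\<close> with
  another value of the logarithm projects to a closed path that winds differently around
  \<open>a\<close> and \<open>b\<close>. To make it simple, restrict it to a shortest parameter
  interval \<open>{s..t}\<close> over which it returns to the same point with a different
  logarithm, and replace it by an arc within its image \<^emph>\<open>in the covering\<close>.
  By minimality, two points of the arc over the same point of \<open>T\<close> coincide or are
  the two ends, so the arc projects to a simple closed curve. If the curve did not separate
  \<open>a\<close> from \<open>b\<close>, then \<open>(z - a) / (z - b)\<close> would have a
  logarithm on it, and the logarithm carried by the arc would take the same value at both ends.\<close>

lemma nontrivial_log_cover_path_imp_separating_curve:
  assumes "a \<noteq> b" "path_component (log_cover T a b) (z, w) (z, w')" "w \<noteq> w'"
  obtains \<gamma> where "simple_closed_curve \<gamma>" "curve_separates \<gamma> a b" "\<gamma> \<subseteq> T"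
proof -
  obtain q where q: "path q" "path_image q \<subseteq> log_cover T a b" "q 0 = (z, w)" "q 1 = (z, w')"
    using assms(2) unfolding path_component_def pathstart_def pathfinish_def by blast
  have q_exp: "exp (snd (q t)) = (fst (q t) - a) / (fst (q t) - b)" and q_T: "fst (q t) \<in> T"
    if "t \<in> {0..1}" for t
    using q(2) that unfolding path_image_def log_cover_def by (force simp: image_subset_iff)+
  have q_cont: "continuous_on {0..1} q" using q(1) by (simp add: path_def)
  \<comment> \<open>Distinct logarithms of one number are at least \<open>2 * pi\<close> apart, so that being distinct is a
    closed condition here; this makes \<open>D\<close> compact and a shortest interval exist.\<close>
  define D where "D = {p \<in> {0..1} \<times> {0..1}. fst p \<le> snd p \<and> fst (q (fst p)) = fst (q (snd p))
      \<and> 2 * pi \<le> norm (snd (q (fst p)) - snd (q (snd p)))}"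
  have D_iff: "(s, t) \<in> D \<longleftrightarrow> 0 \<le> s \<and> s \<le> t \<and> t \<le> 1 \<and> fst (q s) = fst (q t) \<and> snd (q s) \<noteq> snd (q t)"
    for s t
  proof -
    have "2 * pi \<le> norm (snd (q s) - snd (q t))"
      if "0 \<le> s" "s \<le> t" "t \<le> 1" "fst (q s) = fst (q t)" "snd (q s) \<noteq> snd (q t)"
    proof -
      have "exp (snd (q s)) = exp (snd (q t))" using that q_exp by auto
      then show ?thesis using that(5)
        by (metis exp_complex_eqI linorder_not_le minus_complex.simps(2) abs_Im_le_cmod order_le_less_trans)
    qed
    moreover have "snd (q s) \<noteq> snd (q t)" if "2 * pi \<le> norm (snd (q s) - snd (q t))"
      using that pi_gt_zero by force
    ultimately show ?thesis unfolding D_def by auto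
  qed
  have "closed D"
  proof -
    have c1: "continuous_on ({0..1::real} \<times> {0..1::real}) (\<lambda>p. q (fst p))"
      and c2: "continuous_on ({0..1::real} \<times> {0..1::real}) (\<lambda>p. q (snd p))"
      by (auto intro!: continuous_on_compose2 [OF q_cont] continuous_intros)
    have "closed {p \<in> {0..1} \<times> {0..1::real}. fst p \<le> snd p}"
      by (intro continuous_on_closed_Collect_le continuous_intros closed_Times closed_atLeastAtMost)
    moreover have "closed {p \<in> {0..1} \<times> {0..1}. fst (q (fst p)) - fst (q (snd p)) = 0}"
      by (intro continuous_closed_preimage_constant continuous_intros c1 c2 closed_Times closed_atLeastAtMost)
    moreover have "closed {p \<in> {0..1} \<times> {0..1}. 2 * pi \<le> norm (snd (q (fst p)) - snd (q (snd p)))}"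
      by (intro continuous_on_closed_Collect_le continuous_intros c1 c2 closed_Times closed_atLeastAtMost)
    ultimately have "closed ({p \<in> {0..1} \<times> {0..1::real}. fst p \<le> snd p}
       \<inter> {p \<in> {0..1} \<times> {0..1}. fst (q (fst p)) - fst (q (snd p)) = 0}
       \<inter> {p \<in> {0..1} \<times> {0..1}. 2 * pi \<le> norm (snd (q (fst p)) - snd (q (snd p)))})"
      by (intro closed_Int)
    also have "\<dots> = D" unfolding D_def by auto
    finally show ?thesis .
  qed
  then have "compact D"
    using compact_Int_closed [OF compact_Times [OF compact_Icc compact_Icc], of D 0 1 0 1]
    by (simp add: D_def Int_absorb1 subset_iff Collect_conj_eq)
  moreover have "(0, 1) \<in> D" using q assms D_iff by auto
  ultimately obtain d where "d \<in> D" and d_min: "\<And>e. e \<in> D \<Longrightarrow> snd d - fst d \<le> snd e - fst e"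
    using continuous_attains_inf [of D "\<lambda>p. snd p - fst p"] by (force intro: continuous_intros)
  obtain s t where "d = (s, t)" by fastforce
  then have st: "0 \<le> s" "s \<le> t" "t \<le> 1" "fst (q s) = fst (q t)" "snd (q s) \<noteq> snd (q t)"
    and minimal: "\<And>s' t'. (s', t') \<in> D \<Longrightarrow> t - s \<le> t' - s'"
    using \<open>d \<in> D\<close> d_min D_iff by fastforce+
  have "path (subpath s t q)" and "path_image (subpath s t q) = q ` {s..t}"
    using path_subpath [of q s t] q(1) st
    by (auto simp: path_image_subpath_gen closed_segment_eq_real_ivl)
  then obtain r where r: "arc r" "path_image r \<subseteq> q ` {s..t}" "pathstart r = q s" "pathfinish r = q t"
    using path_contains_arc [of "subpath s t q" "q s" "q t"] st by (metis pathstart_subpath pathfinish_subpath)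
  have r_cont: "continuous_on {0..1} r" and r_inj: "inj_on r {0..1}"
    using r(1) by (auto simp: arc_def path_def)
  have r_in: "\<exists>\<tau>\<in>{s..t}. r v = q \<tau>" if "v \<in> {0..1}" for v
    using r(2) that unfolding path_image_def by blast
  define \<gamma> where "\<gamma> = fst \<circ> r"
  have collapse: "u = v \<or> u = 0 \<and> v = 1 \<or> u = 1 \<and> v = 0"
    if uv: "u \<in> {0..1}" "v \<in> {0..1}" "\<gamma> u = \<gamma> v" for u v
  proof -
    obtain \<sigma> \<tau> where \<sigma>: "\<sigma> \<in> {s..t}" "r u = q \<sigma>" and \<tau>: "\<tau> \<in> {s..t}" "r v = q \<tau>"
      using r_in [OF uv(1)] r_in [OF uv(2)] by blast
    have eq: "fst (q \<sigma>) = fst (q \<tau>)" using uv(3) \<sigma> \<tau> by (simp add: \<gamma>_def)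
    have ends: "r 0 = q s" "r 1 = q t" using r by (auto simp: pathstart_def pathfinish_def)
    show ?thesis
    proof (cases "snd (q \<sigma>) = snd (q \<tau>)")
      case True
      then have "r u = r v" using eq \<sigma> \<tau> by (simp add: prod_eq_iff)
      then show ?thesis using r_inj uv by (auto simp: inj_on_def)
    next
      case False
      then have "(\<sigma>, \<tau>) \<in> D \<or> (\<tau>, \<sigma>) \<in> D" using eq \<sigma> \<tau> st unfolding D_iff by auto
      then have "\<sigma> = s \<and> \<tau> = t \<or> \<sigma> = t \<and> \<tau> = s" using minimal \<sigma> \<tau> by fastforce
      then have "r u = r 0 \<and> r v = r 1 \<or> r u = r 1 \<and> r v = r 0" using ends \<sigma> \<tau> by auto
      then show ?thesis using r_inj uv by (auto simp: inj_on_def)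
    qed
  qed
  have "path \<gamma>" unfolding \<gamma>_def path_def by (intro continuous_on_compose r_cont continuous_intros)
  then have "simple_path \<gamma>" using collapse by (auto simp: simple_path_def loop_free_def)
  moreover have "pathfinish \<gamma> = pathstart \<gamma>"
    using r st by (simp add: \<gamma>_def pathfinish_compose pathstart_compose)
  ultimately have scc: "simple_closed_curve (path_image \<gamma>)"
    unfolding simple_closed_curve_def by blast
  have \<gamma>_exp: "exp (snd (r v)) = (\<gamma> v - a) / (\<gamma> v - b)" and "\<gamma> v \<in> T" if "v \<in> {0..1}" for v
    using r_in [OF that] q_exp q_T st by (auto simp: \<gamma>_def)
  then have "path_image \<gamma> \<subseteq> T" by (auto simp: path_image_def)
  have "\<gamma> v \<noteq> a" "\<gamma> v \<noteq> b" if "v \<in> {0..1}" for v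
    using \<gamma>_exp [OF that] \<open>a \<noteq> b\<close> by auto
  then have ab: "a \<notin> path_image \<gamma>" "b \<notin> path_image \<gamma>" unfolding path_image_def by blast+
  have "\<not> connected_component (- path_image \<gamma>) a b"
  proof
    assume "connected_component (- path_image \<gamma>) a b"
    then obtain h where h: "continuous_on (path_image \<gamma>) h"
      "\<And>z. z \<in> path_image \<gamma> \<Longrightarrow> exp (h z) = (z - a) / (z - b)"
      using logarithm_iff_not_separated [OF compact_path_image [OF \<open>path \<gamma>\<close>] ab] by blast
    obtain k where "\<And>v. v \<in> {0..1} \<Longrightarrow> snd (r v) = h (\<gamma> v) + k"
    proof (rule logarithms_differ_by_constant [of "{0..1::real}" "\<lambda>v. snd (r v)" "\<lambda>v. h (\<gamma> v)"])
      show "continuous_on {0..1} (\<lambda>v. h (\<gamma> v))"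
        using \<open>path \<gamma>\<close> by (intro continuous_on_compose2 [OF h(1)]) (auto simp: path_def path_image_def)
    qed (use \<gamma>_exp h(2) in \<open>auto intro!: continuous_intros r_cont simp: path_image_def\<close>)
    then have "snd (r 0) = snd (r 1)"
      using \<open>pathfinish \<gamma> = pathstart \<gamma>\<close> by (simp add: pathstart_def pathfinish_def)
    then show False using r st by (simp add: pathstart_def pathfinish_def)
  qed
  then have "curve_separates (path_image \<gamma>) a b" using ab by (intro curve_separatesI)
  then show thesis using that scc \<open>path_image \<gamma> \<subseteq> T\<close> by blast
qed

text \<open>If the logarithm always returns to its old value along closed paths in
  \<open>T\<close>, then fixing its value at one base point of each path component of
  \<open>T\<close> and continuing it along paths defines a logarithm on all of \<open>T\<close>.
  It can fail to be continuous where \<open>T\<close> is not locally path connected, but on path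
  connected sets it agrees with every continuous logarithm up to a constant.\<close>

lemma univalent_log_cover_imp_logarithm_along_paths:
  fixes T :: "complex set"
  assumes ab: "a \<notin> T" "b \<notin> T"
    and unique: "\<And>z w w'. path_component (log_cover T a b) (z, w) (z, w') \<Longrightarrow> w = w'"
  obtains g where "\<And>z. z \<in> T \<Longrightarrow> exp (g z) = (z - a) / (z - b)"
    and "\<And>U l z z'. \<lbrakk>path_connected U; U \<subseteq> T; continuous_on U l;
            \<And>u. u \<in> U \<Longrightarrow> exp (l u) = (u - a) / (u - b); z \<in> U; z' \<in> U\<rbrakk>
           \<Longrightarrow> g z - l z = g z' - l z'"
proof -
  have f_nz: "(z - a) / (z - b) \<noteq> 0" if "z \<in> T" for z using that ab by auto
  have lift: "path_component (log_cover T a b) (pathstart p, w) (pathfinish p, m 1 - m 0 + w)"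
    if p: "path p" "path_image p \<subseteq> T" "continuous_on {0..1} m"
      "\<And>t. t \<in> {0..1} \<Longrightarrow> exp (m t) = (p t - a) / (p t - b)"
      "exp w = (pathstart p - a) / (pathstart p - b)" for p m w
    unfolding path_component_def
  proof (intro exI conjI)
    let ?q = "\<lambda>t. (p t, m t - m 0 + w)"
    show "path ?q" using p(1,3) unfolding path_def by (intro continuous_intros)
    have "exp (m t - m 0 + w) = (p t - a) / (p t - b)" if t: "t \<in> {0..1}" for t
    proof -
      have "exp w = exp (m 0)" using p(4) [of 0] p(5) by (simp add: pathstart_def)
      then show ?thesis using p(4) [OF t] by (simp add: exp_add exp_diff)
    qed
    then show "path_image ?q \<subseteq> log_cover T a b"
      using p(2) by (auto simp: path_image_def log_cover_def)
  qed (auto simp: pathstart_def pathfinish_def)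
  \<comment> \<open>The choice depends on the path component only, so it is the same for all its points.\<close>
  define base where "base z = (SOME u. u \<in> path_component_set T z)" for z
  have base: "path_component T z (base z)" if "z \<in> T" for z
    using someI [of "\<lambda>u. u \<in> path_component_set T z" z] that
    by (simp add: base_def path_component_refl)
  have base_eq: "base z = base z'" if "path_component T z z'" for z z'
    using path_component_eq [of z' T z] that by (simp add: base_def)
  define l0 where "l0 z = Ln ((base z - a) / (base z - b))" for z
  define g where "g z = (SOME w. path_component (log_cover T a b) (base z, l0 z) (z, w))" for z
  have g: "path_component (log_cover T a b) (base z, l0 z) (z, g z)" if z: "z \<in> T" for z
  proof -
    obtain p where p: "path p" "path_image p \<subseteq> T" "pathstart p = base z" "pathfinish p = z"
      using path_component_sym [OF base [OF z]] unfolding path_component_def by blast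
    have p_T: "p t \<in> T" if "t \<in> {0..1}" for t using p(2) that by (auto simp: path_image_def)
    have "continuous_on {0..1} (\<lambda>t. (p t - a) / (p t - b))"
      using p(1) p_T ab unfolding path_def by (intro continuous_intros) auto
    moreover have "contractible {0..1::real}" by (simp add: convex_imp_contractible)
    ultimately obtain m where m: "continuous_on {0..1} m"
        "\<And>t. t \<in> {0..1} \<Longrightarrow> (p t - a) / (p t - b) = exp (m t)"
      using continuous_logarithm_on_contractible [of "{0..1::real}" "\<lambda>t. (p t - a) / (p t - b)"]
        f_nz p_T by blast
    have "base z \<in> T" using p by (metis pathstart_in_path_image subsetD)
    then have "exp (l0 z) = (base z - a) / (base z - b)" using f_nz by (simp add: l0_def)
    then have "path_component (log_cover T a b) (base z, l0 z) (z, m 1 - m 0 + l0 z)"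
      using lift [OF p(1,2) m(1)] m(2) p(3,4) by simp
    then show ?thesis unfolding g_def by (rule someI)
  qed
  have g_exp: "exp (g z) = (z - a) / (z - b)" if "z \<in> T" for z
    using path_component_mem(2) [OF g [OF that]] by (simp add: log_cover_def)
  have g_const: "g z - l z = g z' - l z'"
    if U: "path_connected U" "U \<subseteq> T" "continuous_on U l"
      and l: "\<And>u. u \<in> U \<Longrightarrow> exp (l u) = (u - a) / (u - b)" and z: "z \<in> U" "z' \<in> U" for U l z z'
  proof -
    obtain p where p: "path p" "path_image p \<subseteq> U" "pathstart p = z" "pathfinish p = z'"
      using U(1) z unfolding path_connected_def by blast
    have "continuous_on {0..1} (\<lambda>t. l (p t))"
      using p(1,2) by (intro continuous_on_compose2 [OF U(3)]) (auto simp: path_def path_image_def)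
    moreover have "exp (l (p t)) = (p t - a) / (p t - b)" if "t \<in> {0..1}" for t
      using l [of "p t"] p(2) that by (auto simp: path_image_def image_subset_iff)
    moreover have "path_image p \<subseteq> T" using p(2) U(2) by blast
    moreover have "exp (g z) = (z - a) / (z - b)" using g_exp z U by blast
    ultimately have "path_component (log_cover T a b) (z, g z) (z', l z' - l z + g z)"
      using lift [of p "\<lambda>t. l (p t)" "g z"] p by (simp add: pathstart_def pathfinish_def)
    moreover have "base z = base z'"
      using base_eq p \<open>path_image p \<subseteq> T\<close> unfolding path_component_def by blast
    then have "path_component (log_cover T a b) (z', g z') (z, g z)"
      using g z U path_component_trans path_component_sym unfolding l0_def by (metis subsetD)
    ultimately have "path_component (log_cover T a b) (z', g z') (z', l z' - l z + g z)"
      by (rule path_component_trans [rotated])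
    then show ?thesis using unique by fastforce
  qed
  show thesis by (rule that [of g]) (fact g_exp, fact g_const)
qed

section \<open>Access to a point from within an open set\<close>

text \<open>Choose a point in each set and a path within the set to the point chosen for the
  next one. Traversing these paths one after the other in finite time leads to \<open>c\<close>,
  because the sets shrink to it.\<close>

lemma nested_connected_open_sets_path:
  fixes V :: "nat \<Rightarrow> 'a::real_normed_vector set"
  assumes open_V: "\<And>n. open (V n)" and conn: "\<And>n. connected (V n)" and ne: "\<And>n. V n \<noteq> {}"
    and dec: "\<And>n. V (Suc n) \<subseteq> V n" and small: "\<And>n. V n \<subseteq> ball c (e n)"
    and e: "e \<longlonglongrightarrow> 0"
  obtains p where "path p" "pathstart p \<in> V 0" "pathfinish p = c" "path_image p \<subseteq> insert c (V 0)"
proof -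
  have anti: "V n \<subseteq> V m" if "m \<le> n" for m n
    using dec that by (rule lift_Suc_antimono_le)
  define x where "x n = (SOME z. z \<in> V n)" for n
  have x: "x n \<in> V n" for n using ne by (simp add: x_def some_in_eq)
  have "\<forall>n. \<exists>q. path q \<and> path_image q \<subseteq> V n \<and> pathstart q = x n \<and> pathfinish q = x (Suc n)"
    using connected_open_path_connected [OF open_V conn] x dec
    unfolding path_connected_def by blast
  from choice [OF this] obtain q where q: "\<And>n. path (q n)" "\<And>n. path_image (q n) \<subseteq> V n"
      "\<And>n. q n 0 = x n" "\<And>n. q n 1 = x (Suc n)"
    unfolding pathstart_def pathfinish_def by blast
  \<comment> \<open>The concatenation of all the paths, with time \<open>{n..n + 1}\<close> spent in \<open>V n\<close>.\<close>
  define h where "h t = q (nat \<lfloor>t\<rfloor>) (t - of_nat (nat \<lfloor>t\<rfloor>))" for t :: real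
  have h_eq: "h t = q n (t - n)" if "t \<in> {real n..real (Suc n)}" for t n
  proof (cases "t = Suc n")
    case True
    then have "nat \<lfloor>t\<rfloor> = Suc n" by auto
    then show ?thesis using True q by (simp add: h_def)
  next
    case False
    then have "\<lfloor>t\<rfloor> = int n" using that by (intro floor_unique) auto
    then show ?thesis by (simp add: h_def)
  qed
  have h_in: "h t \<in> V n" if "real n \<le> t" for t n
  proof -
    define m where "m = nat \<lfloor>t\<rfloor>"
    have m: "real m \<le> t" "t \<le> real (Suc m)" "n \<le> m"
      using that le_nat_floor [of n t] of_nat_floor [of t] unfolding m_def by linarith+
    then have "h t = q m (t - m)" "t - m \<in> {0..1}" using h_eq by auto
    then have "h t \<in> V m" using q(2) [of m] by (auto simp: path_image_def)
    then show ?thesis using anti m by blast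
  qed
  have h_cont: "continuous_on {0..real n} h" for n
  proof (induction n)
    case (Suc n)
    have "continuous_on {real n..real (Suc n)} (\<lambda>t. q n (t - n))"
      by (rule continuous_on_compose2 [OF q(1) [of n, unfolded path_def]])
        (auto intro!: continuous_intros)
    then have "continuous_on {real n..real (Suc n)} h"
      by (rule continuous_on_eq) (rule h_eq [symmetric])
    then have "continuous_on ({0..real n} \<union> {real n..real (Suc n)}) h"
      using Suc by (intro continuous_on_closed_Un) auto
    moreover have "{0..real n} \<union> {real n..real (Suc n)} = {0..real (Suc n)}" by auto
    ultimately show ?case by simp
  qed simp
  \<comment> \<open>The map \<open>\<lambda>t. t / (1 - t)\<close> stretches \<open>{0..<1}\<close> to the half-line.\<close>
  define p where "p t = (if t = 1 then c else h (t / (1 - t)))" for t :: real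
  have "continuous (at t within {0..1}) p" if t: "t \<in> {0..1}" for t
  proof (cases "t = 1")
    case True
    have "\<exists>d>0. \<forall>s\<in>{0..1}. dist s 1 < d \<longrightarrow> dist (p s) (p 1) < \<epsilon>" if "\<epsilon> > 0" for \<epsilon>
    proof -
      have "\<forall>\<^sub>F n in sequentially. e n < \<epsilon>" using e that by (rule order_tendstoD)
      then obtain n where n: "e n < \<epsilon>" by (auto simp: eventually_sequentially)
      have "dist (p s) (p 1) < \<epsilon>" if s: "s \<in> {0..1}" "dist s 1 < 1 / (real n + 1)" for s
      proof (cases "s = 1")
        case False
        then have "0 < 1 - s" "1 - s < 1 / (real n + 1)" using s by (auto simp: dist_real_def)
        then have "real n \<le> s / (1 - s)" by (simp add: field_simps)
        then have "p s \<in> V n" using h_in False by (simp add: p_def)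
        then have "p s \<in> ball c (e n)" using small by blast
        then show ?thesis using n by (simp add: p_def dist_commute)
      qed (use \<open>\<epsilon> > 0\<close> in simp)
      then show ?thesis by (intro exI [of _ "1 / (real n + 1)"]) auto
    qed
    then show ?thesis unfolding True continuous_within_eps_delta by blast
  next
    case False
    then have "t < 1" using t by auto
    obtain n where n: "t / (1 - t) < real n" using reals_Archimedean2 by blast
    define s where "s = real n / (real n + 1)"
    have "t < s" "s < 1" using n \<open>t < 1\<close> by (simp_all add: s_def field_simps)
    have "continuous_on {0..s} p"
    proof (rule continuous_on_eq)
      have "u / (1 - u) \<le> real n" if "0 \<le> u" "u \<le> s" for u
      proof -
        have "u < 1" using that \<open>s < 1\<close> by simp
        then show ?thesis using that by (simp add: s_def field_simps)
      qed
      then show "continuous_on {0..s} (\<lambda>u. h (u / (1 - u)))"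
        using \<open>s < 1\<close>
        by (intro continuous_on_compose2 [OF h_cont [of n]]) (auto intro!: continuous_intros)
    qed (use \<open>s < 1\<close> in \<open>auto simp: p_def\<close>)
    then have "continuous (at t within {0..s}) p"
      using t \<open>t < s\<close> by (simp add: continuous_on_eq_continuous_within)
    moreover have "at t within {0..s} = at t within {0..1}"
      by (rule at_within_nhd [of _ "{..<s}"]) (use \<open>t < s\<close> \<open>s < 1\<close> in auto)
    ultimately show ?thesis by simp
  qed
  then have "path p" by (simp add: path_def continuous_on_eq_continuous_within)
  have "p t \<in> insert c (V 0)" if "t \<in> {0..1}" for t
    using that h_in [of 0 "t / (1 - t)"] by (auto simp: p_def)
  then have "path_image p \<subseteq> insert c (V 0)" unfolding path_image_def by blast
  moreover have "pathstart p \<in> V 0" using h_in [of 0 0] by (simp add: p_def pathstart_def)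
  ultimately show thesis using that \<open>path p\<close> by (simp add: p_def pathfinish_def)
qed

text \<open>The points of \<open>S \<inter> V\<close> near \<open>c\<close> can be cut off:
  \<open>S \<inter> V\<close> falls into two relatively open parts, of which one contains all
  its points close to \<open>c\<close> and stays within half the radius. A function on
  \<open>S\<close> may be changed on this part without losing its continuity in
  \<open>V\<close>.\<close>

definition detachable :: "complex set \<Rightarrow> complex \<Rightarrow> real \<Rightarrow> complex set \<Rightarrow> bool" where
  "detachable S c r V \<longleftrightarrow>
     (\<exists>P Q \<rho>. open P \<and> open Q \<and> P \<inter> Q = {} \<and> P \<subseteq> V \<inter> ball c (r / 2) \<and> Q \<subseteq> V \<and>
            S \<inter> V \<subseteq> P \<union> Q \<and> 0 < \<rho> \<and> S \<inter> V \<inter> ball c \<rho> \<subseteq> P)"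

text \<open>Only finitely many components of the half ball in \<open>V\<close> meet
  \<open>S\<close> on the sphere of a quarter of the radius, by compactness. In each of them use
  the given splitting; in all others \<open>S\<close> does not cross that sphere, so that the
  part of \<open>S\<close> inside it can be cut off as it is. Openness of \<open>G \<inter> ball
  c r - V\<close> says that \<open>V\<close> consists of whole components of \<open>G \<inter>
  ball c r\<close>, so that \<open>S\<close> cannot reach the boundary of \<open>V\<close>
  within the ball other than at \<open>c\<close>.\<close>

lemma detachable_if_components_detachable:
  assumes "closed S" "0 < r" and S_G: "S \<inter> ball c r \<subseteq> insert c G"
    and V: "open V" "V \<subseteq> G \<inter> ball c r" "open (G \<inter> ball c r - V)"
    and comps: "\<And>V'. V' \<in> components (V \<inter> ball c (r / 2)) \<Longrightarrow> detachable S c (r / 2) V'"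
  shows "detachable S c r V"
proof -
  define \<V> where "\<V> = components (V \<inter> ball c (r / 2))"
  have \<V>_open: "open V'" if "V' \<in> \<V>" for V'
    using that V(1) open_components unfolding \<V>_def by blast
  have \<V>_Un: "\<Union>\<V> = V \<inter> ball c (r / 2)" unfolding \<V>_def by (rule Union_components)
  have \<V>_disj: "V' \<inter> V'' = {}" if "V' \<in> \<V>" "V'' \<in> \<V>" "V' \<noteq> V''" for V' V''
    using that components_nonoverlap unfolding \<V>_def by blast
  have "S \<inter> sphere c (r / 4) \<inter> V = S \<inter> sphere c (r / 4) - (G \<inter> ball c r - V)"
    using S_G V(2) \<open>0 < r\<close> by (auto simp: dist_commute)
  moreover have "compact (S \<inter> sphere c (r / 4) - (G \<inter> ball c r - V))"
    using \<open>closed S\<close> V(3) by (intro compact_diff closed_Int_compact) auto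
  ultimately have "compact (S \<inter> sphere c (r / 4) \<inter> V)" by simp
  moreover have "S \<inter> sphere c (r / 4) \<inter> V \<subseteq> \<Union>\<V>"
    using \<open>0 < r\<close> unfolding \<V>_Un by auto
  ultimately obtain F where F: "F \<subseteq> \<V>" "finite F" "S \<inter> sphere c (r / 4) \<inter> V \<subseteq> \<Union>F"
    using \<V>_open compactE by metis
  define det where "det V' P Q \<rho> \<longleftrightarrow> open P \<and> open Q \<and> P \<inter> Q = {} \<and> P \<subseteq> V' \<inter> ball c (r / 4) \<and> Q \<subseteq> V' \<and>
            S \<inter> V' \<subseteq> P \<union> Q \<and> 0 < \<rho> \<and> S \<inter> V' \<inter> ball c \<rho> \<subseteq> P" for V' P Q and \<rho> :: real
  have "\<exists>P Q \<rho>. det V' P Q \<rho>" if "V' \<in> F" for V'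
  proof -
    have "detachable S c (r / 2) V'" using that comps F(1) unfolding \<V>_def by blast
    then show ?thesis by (simp add: detachable_def det_def)
  qed
  then obtain P Q \<rho> where det: "\<And>V'. V' \<in> F \<Longrightarrow> det V' (P V') (Q V') (\<rho> V')"
    by metis
  have PQ: "\<And>V'. V' \<in> F \<Longrightarrow> open (P V')" "\<And>V'. V' \<in> F \<Longrightarrow> open (Q V')"
      "\<And>V'. V' \<in> F \<Longrightarrow> P V' \<inter> Q V' = {}" "\<And>V'. V' \<in> F \<Longrightarrow> P V' \<subseteq> V' \<inter> ball c (r / 4)"
      "\<And>V'. V' \<in> F \<Longrightarrow> Q V' \<subseteq> V'" "\<And>V'. V' \<in> F \<Longrightarrow> S \<inter> V' \<subseteq> P V' \<union> Q V'"
      "\<And>V'. V' \<in> F \<Longrightarrow> 0 < \<rho> V'" "\<And>V'. V' \<in> F \<Longrightarrow> S \<inter> V' \<inter> ball c (\<rho> V') \<subseteq> P V'"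
    using det unfolding det_def by blast+
  define P' where "P' = (\<Union>V'\<in>F. P V') \<union> ball c (r / 4) \<inter> \<Union>(\<V> - F)"
  define Q' where "Q' = (V - cball c (r / 4)) \<union> (\<Union>V'\<in>F. Q V')"
  define \<rho>' where "\<rho>' = Min (insert (r / 4) (\<rho> ` F))"
  have \<rho>': "0 < \<rho>'" "\<rho>' \<le> r / 4" "\<And>V'. V' \<in> F \<Longrightarrow> \<rho>' \<le> \<rho> V'"
    using F(2) PQ(7) \<open>0 < r\<close> Min_le [of "insert (r / 4) (\<rho> ` F)"]
    by (auto simp only: \<rho>'_def Min_gr_iff finite_insert finite_imageI) auto
  have "open P'" "open Q'"
    using PQ(1,2) V(1) \<V>_open unfolding P'_def Q'_def by (auto intro!: open_Un open_Int open_Union open_Diff)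
  have cases: "s \<in> V' \<Longrightarrow> V' \<in> F \<Longrightarrow> s \<notin> \<Union>(\<V> - F)" for s V' using \<V>_disj F(1) by blast
  have P_V: "P V' \<subseteq> V'" "P V' \<subseteq> ball c (r / 4)" if "V' \<in> F" for V' using PQ(4) that by blast+
  have "P' \<subseteq> ball c (r / 4)" unfolding P'_def using P_V by blast
  have "P' \<subseteq> \<Union>\<V>" unfolding P'_def using P_V F(1) by blast
  have "Q' \<subseteq> V" unfolding Q'_def using PQ(5) F(1) \<V>_Un by blast
  have "P V' \<inter> Q V'' = {}" if "V' \<in> F" "V'' \<in> F" for V' V''
  proof (cases "V' = V''")
    case False
    then have "V' \<inter> V'' = {}" using that F(1) \<V>_disj by blast
    then show ?thesis using P_V(1) PQ(5) that by blast
  qed (use PQ(3) that in auto)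
  moreover have "\<Union>(\<V> - F) \<inter> Q V' = {}" if "V' \<in> F" for V'
    using PQ(5) [OF that] cases that by blast
  ultimately have "P' \<inter> (\<Union>V'\<in>F. Q V') = {}" unfolding P'_def by blast
  moreover have "P' \<inter> (V - cball c (r / 4)) = {}"
    using \<open>P' \<subseteq> ball c (r / 4)\<close> ball_subset_cball by blast
  ultimately have "P' \<inter> Q' = {}" unfolding Q'_def by blast
  have "s \<in> P' \<union> Q'" if s: "s \<in> S" "s \<in> V" for s
  proof (cases "s \<in> cball c (r / 4)")
    case True
    then have "s \<in> ball c (r / 2)" using \<open>0 < r\<close> by auto
    then obtain V' where V': "V' \<in> \<V>" "s \<in> V'" using \<V>_Un s by blast
    have "V' \<in> F" if "s \<notin> ball c (r / 4)"
    proof -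
      have "s \<in> sphere c (r / 4)" using that True by auto
      then obtain V'' where "V'' \<in> F" "s \<in> V''" using F(3) s by blast
      then show ?thesis using \<V>_disj V' F(1) by blast
    qed
    then consider "V' \<in> F" | "V' \<notin> F" "s \<in> ball c (r / 4)" by blast
    then show ?thesis
    proof cases
      case 1
      then show ?thesis using PQ(6) V' s unfolding P'_def Q'_def by blast
    next
      case 2
      then show ?thesis using V' unfolding P'_def by blast
    qed
  qed (use s in \<open>auto simp: Q'_def\<close>)
  then have "S \<inter> V \<subseteq> P' \<union> Q'" by blast
  have "s \<in> P'" if s: "s \<in> S" "s \<in> V" "s \<in> ball c \<rho>'" for s
  proof -
    have r4: "s \<in> ball c (r / 4)" "s \<in> ball c (r / 2)" using s(3) \<rho>'(2) \<open>0 < r\<close> by auto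
    then obtain V' where V': "V' \<in> \<V>" "s \<in> V'" using \<V>_Un s by blast
    show ?thesis
    proof (cases "V' \<in> F")
      case True
      then have "s \<in> ball c (\<rho> V')" using s(3) \<rho>'(3) by fastforce
      then show ?thesis using PQ(8) True V' s unfolding P'_def by blast
    qed (use r4 V' in \<open>auto simp: P'_def\<close>)
  qed
  then have "S \<inter> V \<inter> ball c \<rho>' \<subseteq> P'" by blast
  have "P' \<subseteq> V \<inter> ball c (r / 2)" using \<open>P' \<subseteq> \<Union>\<V>\<close> \<V>_Un by blast
  show ?thesis unfolding detachable_def
    by (rule exI [of _ P'], rule exI [of _ Q'], rule exI [of _ \<rho>'], intro conjI) fact+
qed

text \<open>This is Koenig's lemma: if \<open>V\<close> is not detachable, then some component
  of its intersection with the ball of half the radius is not detachable either, and so on. The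
  sequence of nested components obtained in this way carries a path to \<open>c\<close>.\<close>

lemma not_detachable_imp_accessible:
  assumes "closed S" "0 < r" and S_G: "S \<inter> ball c r \<subseteq> insert c G"
    and V: "open V" "V \<subseteq> G \<inter> ball c r" "open (G \<inter> ball c r - V)"
    and nd: "\<not> detachable S c r V"
  obtains W p where "connected W" "W \<subseteq> V" "path p" "pathstart p \<in> W" "pathfinish p = c"
    "path_image p \<subseteq> insert c W"
proof -
  define good where "good n U \<longleftrightarrow> U \<subseteq> V \<and> open U \<and> U \<subseteq> G \<inter> ball c (r / 2 ^ n) \<and>
      open (G \<inter> ball c (r / 2 ^ n) - U) \<and> \<not> detachable S c (r / 2 ^ n) U" for n U
  have "\<exists>f. \<forall>n. good n (f n) \<and> f (Suc n) \<in> components (f n \<inter> ball c (r / 2 ^ Suc n))"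
  proof (rule dependent_nat_choice)
    show "\<exists>U. good 0 U" using V nd unfolding good_def by auto
    fix U n assume U: "good n U"
    define s where "s = r / 2 ^ n"
    have s: "0 < s" "s \<le> r" "r / 2 ^ Suc n = s / 2"
      using \<open>0 < r\<close> by (auto simp: s_def divide_le_eq_1 field_simps)
    have U': "open U" "U \<subseteq> G \<inter> ball c s" "open (G \<inter> ball c s - U)" "\<not> detachable S c s U"
      using U by (simp_all add: good_def s_def)
    have "S \<inter> ball c s \<subseteq> insert c G" using S_G s(2) by fastforce
    then obtain U1 where U1: "U1 \<in> components (U \<inter> ball c (s / 2))" "\<not> detachable S c (s / 2) U1"
      using detachable_if_components_detachable [OF \<open>closed S\<close> s(1) _ U'(1-3)] U'(4) by blast
    have "open (U \<inter> ball c (s / 2))" using U' by auto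
    then have "open U1" using U1 open_components by blast
    have "U1 \<subseteq> U \<inter> ball c (s / 2)" using U1 in_components_subset by blast
    moreover have "\<Union>(components (U \<inter> ball c (s / 2)) - {U1}) = U \<inter> ball c (s / 2) - U1"
      using U1(1) components_nonoverlap [of _ "U \<inter> ball c (s / 2)"] Union_components [of "U \<inter> ball c (s / 2)"]
      by blast
    moreover have "ball c (s / 2) \<subseteq> ball c s" using s(1) by (simp add: subset_ball)
    ultimately have "G \<inter> ball c (s / 2) - U1 =
        (G \<inter> ball c s - U) \<inter> ball c (s / 2) \<union> \<Union>(components (U \<inter> ball c (s / 2)) - {U1})"
      using U'(2) by blast
    moreover have "open \<dots>"
      using U'(3) open_components [OF \<open>open (U \<inter> ball c (s / 2))\<close>] by (intro open_Un open_Int open_Union) auto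
    ultimately have "good (Suc n) U1"
      using U1 \<open>open U1\<close> \<open>U1 \<subseteq> U \<inter> ball c (s / 2)\<close> U'(2) U
      unfolding good_def s(3) by auto
    then show "\<exists>U1. good (Suc n) U1 \<and> U1 \<in> components (U \<inter> ball c (r / 2 ^ Suc n))"
      using U1 unfolding s(3) by blast
  qed
  then obtain f where f_good: "\<And>n. good n (f n)"
    and f_comp: "\<And>n. f (Suc n) \<in> components (f n \<inter> ball c (r / 2 ^ Suc n))"
    by blast
  have f_open: "open (f n)" and f_ball: "f n \<subseteq> ball c (r / 2 ^ n)" and f_V: "f n \<subseteq> V" for n
    using f_good [of n] by (auto simp: good_def)
  have f_Suc: "f (Suc n) \<subseteq> f n" for n
    using in_components_subset [OF f_comp [of n]] by blast
  have "(\<lambda>n. r / 2 ^ Suc n) \<longlonglongrightarrow> 0"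
    using LIMSEQ_divide_realpow_zero [of 2 r] by (rule LIMSEQ_Suc) simp
  then obtain p where "path p" "pathstart p \<in> f (Suc 0)" "pathfinish p = c"
      "path_image p \<subseteq> insert c (f (Suc 0))"
    using nested_connected_open_sets_path [of "\<lambda>n. f (Suc n)" c "\<lambda>n. r / 2 ^ Suc n"]
      f_open f_ball f_Suc in_components_connected [OF f_comp] in_components_nonempty [OF f_comp]
    by metis
  then show thesis
    using that [of "f (Suc 0)" p] in_components_connected [OF f_comp [of 0]] f_V by blast
qed

section \<open>Separating curves from separating compact sets\<close>

lemma finite_set_uniform_gap:
  fixes A :: "'a::metric_space set"
  assumes "finite A"
  obtains r where "0 < r" "\<And>u v. \<lbrakk>u \<in> A; v \<in> A; u \<noteq> v\<rbrakk> \<Longrightarrow> 2 * r \<le> dist u v"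
proof -
  define M where "M = insert 1 ((\<lambda>(u, v). dist u v) ` {p \<in> A \<times> A. fst p \<noteq> snd p})"
  have "finite M" using assms by (simp add: M_def)
  moreover have "\<forall>d\<in>M. 0 < d" by (auto simp: M_def)
  ultimately have "0 < Min M" by (simp add: M_def Min_gr_iff)
  moreover have "Min M \<le> dist u v" if "u \<in> A" "v \<in> A" "u \<noteq> v" for u v
    using that \<open>finite M\<close> by (intro Min_le) (auto simp: M_def image_iff)
  ultimately show thesis by (intro that [of "Min M / 2"]) auto
qed

lemma continuous_on_if_locally_eq:
  fixes f :: "'a::t2_space \<Rightarrow> 'b::topological_space"
  assumes "\<And>z. z \<in> S \<Longrightarrow> \<exists>N h. open N \<and> z \<in> N \<and> continuous_on (S \<inter> N) h \<and> (\<forall>y\<in>S \<inter> N. f y = h y)"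
  shows "continuous_on S f"
  unfolding continuous_on_eq_continuous_within
proof
  fix z assume z: "z \<in> S"
  obtain N h where N: "open N" "z \<in> N" "continuous_on (S \<inter> N) h" "\<And>y. y \<in> S \<inter> N \<Longrightarrow> f y = h y"
    using assms [OF z] by blast
  have "continuous_on (S \<inter> N) f" using N(4) by (intro continuous_on_eq [OF N(3)]) simp
  then have "continuous (at z within S \<inter> N) f"
    using z N(2) by (simp add: continuous_on_eq_continuous_within)
  moreover have "at z within S \<inter> N = at z within S"
    by (rule at_within_nhd [OF N(2,1)]) blast
  ultimately show "continuous (at z within S) f" by simp
qed

text \<open>Let \<open>g\<close> be the logarithm on \<open>H \<union> C\<close> obtained by
  continuation along paths. It is continuous on the open set \<open>H\<close>, but perhaps not
  at a point \<open>c\<close> of \<open>C\<close>. Near \<open>c\<close> compare it with the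
  continuous logarithm \<open>l c\<close> that has the value \<open>g c\<close> at
  \<open>c\<close>. On every component of \<open>H \<inter> ball c r\<close> from which a path
  leads to \<open>c\<close>, the two agree. The other components form a set \<open>V c\<close>
  in which the part of \<open>S\<close> near \<open>c\<close> is detachable; replacing
  \<open>g\<close> by \<open>l c\<close> on the detached part \<open>P c\<close> gives a
  logarithm that is continuous on all of \<open>S\<close>, and hence \<open>S\<close> does not
  separate \<open>a\<close> from \<open>b\<close>.\<close>

lemma univalent_log_cover_imp_not_separated:
  fixes a b :: complex
  assumes "open H" "finite C" "C \<inter> H = {}" "compact S" "S \<subseteq> H \<union> C"
    and ab: "a \<notin> H \<union> C" "b \<notin> H \<union> C" "a \<noteq> b"
    and unique: "\<And>z w w'. path_component (log_cover (H \<union> C) a b) (z, w) (z, w') \<Longrightarrow> w = w'"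
  shows "connected_component (- S) a b"
proof -
  obtain g where g0: "\<And>z. z \<in> H \<union> C \<Longrightarrow> exp (g z) = (z - a) / (z - b)"
    and g1: "\<And>U l z z'. \<lbrakk>path_connected U; U \<subseteq> H \<union> C; continuous_on U l;
            \<And>u. u \<in> U \<Longrightarrow> exp (l u) = (u - a) / (u - b); z \<in> U; z' \<in> U\<rbrakk>
           \<Longrightarrow> g z - l z = g z' - l z'"
  proof (rule univalent_log_cover_imp_logarithm_along_paths [OF ab(1,2)])
    show "w = w'" if "path_component (log_cover (H \<union> C) a b) (z, w) (z, w')" for z w w'
      using that by (rule unique)
    fix g
    assume g0: "\<And>z. z \<in> H \<union> C \<Longrightarrow> exp (g z) = (z - a) / (z - b)"
      and g1: "\<And>U l z z'. \<lbrakk>path_connected U; U \<subseteq> H \<union> C; continuous_on U l;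
            \<And>u. u \<in> U \<Longrightarrow> exp (l u) = (u - a) / (u - b); z \<in> U; z' \<in> U\<rbrakk>
           \<Longrightarrow> g z - l z = g z' - l z'"
    show thesis by (rule that [of g]) (fact g0, fact g1)
  qed
  define f where "f z = (z - a) / (z - b)" for z
  note g_exp = g0 [folded f_def] and g = g1 [folded f_def]
  obtain r where r: "0 < r"
    and gap: "\<And>u v. \<lbrakk>u \<in> insert a (insert b C); v \<in> insert a (insert b C); u \<noteq> v\<rbrakk> \<Longrightarrow> 2 * r \<le> dist u v"
    using finite_set_uniform_gap [of "insert a (insert b C)"] \<open>finite C\<close> by auto
  have far: "a \<notin> ball c r" "b \<notin> ball c r" "\<And>c'. c' \<in> C \<Longrightarrow> c' \<noteq> c \<Longrightarrow> ball c r \<inter> ball c' r = {}"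
    if "c \<in> C" for c
  proof -
    have "2 * r \<le> dist c a" "2 * r \<le> dist c b" using gap that ab by auto
    then show "a \<notin> ball c r" "b \<notin> ball c r" using r by auto
    show "ball c r \<inter> ball c' r = {}" if "c' \<in> C" "c' \<noteq> c" for c'
      using gap [of c c'] that \<open>c \<in> C\<close> by (intro disjoint_ballI) auto
  qed
  have log_ball: "\<exists>l. continuous_on (ball z e) l \<and> (\<forall>u\<in>ball z e. exp (l u) = f u)"
    if ab': "a \<notin> ball z e" "b \<notin> ball z e" for z e
  proof -
    have "continuous_on (ball z e) f"
      using ab' unfolding f_def by (intro continuous_intros) auto
    moreover have "f u \<noteq> 0" if "u \<in> ball z e" for u
      using ab' that unfolding f_def by auto
    ultimately obtain l where "continuous_on (ball z e) l" "\<And>u. u \<in> ball z e \<Longrightarrow> f u = exp (l u)"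
      using continuous_logarithm_on_ball by blast
    then show ?thesis by (intro exI [of _ l]) simp
  qed
  have g_cont: "continuous_on H g"
  proof (rule continuous_on_if_locally_eq)
    fix z assume "z \<in> H"
    then obtain e where e: "0 < e" "ball z e \<subseteq> H" using \<open>open H\<close> openE by blast
    then have "a \<notin> ball z e" "b \<notin> ball z e" using ab by auto
    then obtain l where l: "continuous_on (ball z e) l" "\<And>u. u \<in> ball z e \<Longrightarrow> exp (l u) = f u"
      using log_ball by blast
    have "g u - l u = g z - l z" if u: "u \<in> ball z e" for u
    proof (rule g)
      show "path_connected (ball z e)" by (simp add: convex_imp_path_connected)
      show "ball z e \<subseteq> H \<union> C" using e(2) by blast
    qed (use l e(1) u in simp_all)
    then have "g u = l u + (g z - l z)" if "u \<in> ball z e" for u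
      using that by (metis add.commute diff_add_cancel)
    moreover have "continuous_on (H \<inter> ball z e) (\<lambda>u. l u + (g z - l z))"
      by (intro continuous_intros continuous_on_subset [OF l(1)]) blast
    ultimately show "\<exists>N h. open N \<and> z \<in> N \<and> continuous_on (H \<inter> N) h \<and> (\<forall>y\<in>H \<inter> N. g y = h y)"
      using e(1) by (metis Int_iff centre_in_ball open_ball)
  qed
  have "\<exists>l. continuous_on (ball c r) l \<and> (\<forall>u\<in>ball c r. exp (l u) = f u) \<and> l c = g c" if c: "c \<in> C" for c
  proof -
    obtain l where l: "continuous_on (ball c r) l" "\<And>u. u \<in> ball c r \<Longrightarrow> exp (l u) = f u"
      using log_ball [OF far(1,2) [OF c]] by blast
    have "exp (l c) = exp (g c)" using l(2) [of c] g_exp c r by simp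
    then have "exp (l u + (g c - l c)) = f u" if "u \<in> ball c r" for u
      using l(2) [OF that] by (simp add: exp_add exp_diff)
    then show ?thesis
      using l(1) by (intro exI [of _ "\<lambda>u. l u + (g c - l c)"]) (auto intro!: continuous_intros)
  qed
  then obtain l where l_cont: "\<And>c. c \<in> C \<Longrightarrow> continuous_on (ball c r) (l c)"
    and l_exp: "\<And>c u. \<lbrakk>c \<in> C; u \<in> ball c r\<rbrakk> \<Longrightarrow> exp (l c u) = f u"
    and l_base: "\<And>c. c \<in> C \<Longrightarrow> l c c = g c"
    by metis
  define inaccessible where "inaccessible c W \<longleftrightarrow>
      \<not> (\<exists>p. path p \<and> pathstart p \<in> W \<and> pathfinish p = c \<and> path_image p \<subseteq> insert c W)" for c :: complex and W
  define V where "V c = \<Union>{W \<in> components (H \<inter> ball c r). inaccessible c W}" for c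
  have comp_open: "open W" if "W \<in> components (H \<inter> ball c r)" for c W
    using that \<open>open H\<close> open_components by blast
  have V_open: "open (V c)" and V_sub: "V c \<subseteq> H \<inter> ball c r"
    and V_co: "H \<inter> ball c r - V c = \<Union>{W \<in> components (H \<inter> ball c r). \<not> inaccessible c W}" for c
  proof -
    show "open (V c)" unfolding V_def using comp_open by (intro open_Union) auto
    show "V c \<subseteq> H \<inter> ball c r" unfolding V_def using in_components_subset by blast
    show "H \<inter> ball c r - V c = \<Union>{W \<in> components (H \<inter> ball c r). \<not> inaccessible c W}"
      unfolding V_def using components_nonoverlap [of _ "H \<inter> ball c r"]
        Union_components [of "H \<inter> ball c r"] by blast
  qed
  have V_co_open: "open (H \<inter> ball c r - V c)" for c
    unfolding V_co using comp_open by (intro open_Union) auto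
  have "detachable S c r (V c)" if c: "c \<in> C" for c
  proof (rule ccontr)
    assume "\<not> detachable S c r (V c)"
    moreover have "S \<inter> ball c r \<subseteq> insert c H"
    proof
      fix z assume z: "z \<in> S \<inter> ball c r"
      show "z \<in> insert c H"
      proof (cases "z \<in> C")
        case True
        then show ?thesis using far(3) [OF c, of z] z r by force
      qed (use z \<open>S \<subseteq> H \<union> C\<close> in blast)
    qed
    ultimately obtain W p where W: "connected W" "W \<subseteq> V c" and p: "path p" "pathstart p \<in> W"
        "pathfinish p = c" "path_image p \<subseteq> insert c W"
      using not_detachable_imp_accessible [OF compact_imp_closed [OF \<open>compact S\<close>] r _ V_open V_sub V_co_open]
      by metis
    obtain Y where Y: "Y \<in> components (H \<inter> ball c r)" "inaccessible c Y" "pathstart p \<in> Y"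
      using W(2) p(2) unfolding V_def by blast
    have "W \<subseteq> Y"
      using components_maximal [OF Y(1) W(1)] W(2) V_sub p(2) Y(3) by blast
    then show False using Y p unfolding inaccessible_def by blast
  qed
  then obtain P Q \<rho> where PQ: "\<And>c. c \<in> C \<Longrightarrow> open (P c) \<and> open (Q c) \<and> P c \<inter> Q c = {} \<and>
      P c \<subseteq> V c \<inter> ball c (r / 2) \<and> Q c \<subseteq> V c \<and> S \<inter> V c \<subseteq> P c \<union> Q c \<and> 0 < \<rho> c \<and>
      S \<inter> V c \<inter> ball c (\<rho> c) \<subseteq> P c"
    unfolding detachable_def by metis
  have P_ball: "P c \<subseteq> ball c r" if "c \<in> C" for c using PQ [OF that] V_sub by blast
  have P_unique: "c = c'" if "c \<in> C" "c' \<in> C" "z \<in> P c" "z \<in> ball c' r" for c c' z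
    using far(3) [OF that(1,2)] P_ball that by blast
  define G where "G z = (if \<exists>c\<in>C. z \<in> P c then l (THE c. c \<in> C \<and> z \<in> P c) z else g z)" for z
  have G_P: "G z = l c z" if "c \<in> C" "z \<in> P c" for z c
  proof -
    have "(THE c. c \<in> C \<and> z \<in> P c) = c"
      using that P_unique P_ball by (intro the_equality) blast+
    then show ?thesis using that by (auto simp: G_def)
  qed
  have G_g: "G z = g z" if "\<And>c. c \<in> C \<Longrightarrow> z \<notin> P c" for z
    using that by (auto simp: G_def)
  have G_exp: "exp (G z) = f z" if "z \<in> S" for z
  proof (cases "\<exists>c\<in>C. z \<in> P c")
    case True
    then show ?thesis using G_P l_exp P_ball by (metis subsetD)
  next
    case False
    then show ?thesis using G_g g_exp that \<open>S \<subseteq> H \<union> C\<close> by auto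
  qed
  \<comment> \<open>Close to \<open>c\<close> the modified logarithm is the branch \<open>l c\<close>, on and off the detached part.\<close>
  have near_C: "G z = l c z" if c: "c \<in> C" and z: "z \<in> S" "z \<in> ball c (min r (\<rho> c))" for c z
  proof -
    have zr: "z \<in> ball c r" "z \<in> ball c (\<rho> c)" using z(2) by auto
    show ?thesis
    proof (cases "z \<in> P c")
      case False
      then have "z \<notin> V c" using PQ [OF c] z(1) zr by blast
      have "z \<notin> P c'" if "c' \<in> C" for c' using P_unique [OF that c] zr(1) False by blast
      then have "G z = g z" by (rule G_g)
      also have "g z = l c z"
      proof (cases "z = c")
        case True
        then show ?thesis using l_base c by simp
      next
        case neq: False
        have "z \<notin> C" using far(3) [OF c, of z] neq zr(1) r by force
        then have "z \<in> H \<inter> ball c r - V c" using z(1) zr \<open>S \<subseteq> H \<union> C\<close> \<open>z \<notin> V c\<close> by blast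
        then obtain W where W: "W \<in> components (H \<inter> ball c r)" "\<not> inaccessible c W" "z \<in> W"
          unfolding V_co by blast
        obtain p where p: "path p" "pathstart p \<in> W" "pathfinish p = c" "path_image p \<subseteq> insert c W"
          using W(2) unfolding inaccessible_def by blast
        have W_sub: "W \<subseteq> H \<inter> ball c r" using W(1) by (rule in_components_subset)
        have "path_connected W"
          using W(1) comp_open in_components_connected connected_open_path_connected by blast
        then have "path_connected (W \<union> path_image p)"
          using p(2) path_connected_path_image [OF p(1)]
          by (intro path_connected_Un) auto
        moreover have "c \<in> path_image p" using p(3) pathfinish_in_path_image by blast
        then have "W \<union> path_image p = insert c W" using p(4) by blast
        ultimately have "path_connected (insert c W)" by simp
        moreover have "insert c W \<subseteq> ball c r" using W_sub r by auto
        ultimately have "g z - l c z = g c - l c c"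
          using W W_sub c l_exp by (intro g [of "insert c W" "l c"] continuous_on_subset [OF l_cont [OF c]]) auto
        then show ?thesis using l_base c by simp
      qed
      finally show ?thesis .
    qed (use G_P c in simp)
  qed
  \<comment> \<open>Off \<open>C\<close>, the detached parts are relatively closed in \<open>S\<close>, so the change is harmless there.\<close>
  have away: "z \<notin> closure (P c)" if c: "c \<in> C" and z: "z \<in> S" "z \<in> H" "z \<notin> P c" for c z
  proof -
    have "\<exists>N. open N \<and> z \<in> N \<and> N \<inter> P c = {}"
    proof (cases "z \<in> V c")
      case True
      then have "z \<in> Q c" using PQ [OF c] z by blast
      then show ?thesis using PQ [OF c] by (intro exI [of _ "Q c"]) blast
    next
      case False
      show ?thesis
      proof (cases "z \<in> ball c r")
        case True
        then have "z \<in> H \<inter> ball c r - V c" using z False by blast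
        moreover have "(H \<inter> ball c r - V c) \<inter> P c = {}" using PQ [OF c] by blast
        ultimately show ?thesis using V_co_open [of c] by (intro exI [of _ "H \<inter> ball c r - V c"]) simp
      next
        case False
        then have "z \<in> - cball c (r / 2)" using r by auto
        moreover have "- cball c (r / 2) \<inter> P c = {}" using PQ [OF c] by force
        ultimately show ?thesis by (intro exI [of _ "- cball c (r / 2)"]) (simp add: open_Compl)
      qed
    qed
    then obtain N where "open N" "z \<in> N" "N \<inter> P c = {}" by (elim exE conjE)
    then show ?thesis using open_Int_closure_eq_empty [of N "P c"] by blast
  qed
  have "continuous_on S G"
  proof (rule continuous_on_if_locally_eq)
    fix z assume z: "z \<in> S"
    show "\<exists>N h. open N \<and> z \<in> N \<and> continuous_on (S \<inter> N) h \<and> (\<forall>y\<in>S \<inter> N. G y = h y)"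
    proof (cases "\<exists>c\<in>C. z = c \<or> z \<in> P c")
      case True
      then consider c where "c \<in> C" "z = c" | c where "c \<in> C" "z \<in> P c" by blast
      then show ?thesis
      proof cases
        case 1
        let ?N = "ball c (min r (\<rho> c))"
        have "continuous_on (S \<inter> ?N) (l c)"
          using 1 by (intro continuous_on_subset [OF l_cont [of c]]) auto
        moreover have "z \<in> ?N" using 1 r PQ [of c] by simp
        ultimately show ?thesis using near_C 1 by (intro exI [of _ ?N] exI [of _ "l c"]) blast
      next
        case 2
        have "continuous_on (S \<inter> P c) (l c)"
          using 2 P_ball by (intro continuous_on_subset [OF l_cont [of c]]) auto
        then show ?thesis using 2 PQ [of c] G_P by (intro exI [of _ "P c"] exI [of _ "l c"]) blast
      qed
    next
      case False
      let ?N = "H - (\<Union>c\<in>C. closure (P c))"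
      have "z \<in> H" using z False \<open>S \<subseteq> H \<union> C\<close> by blast
      then have "z \<in> ?N" using away z False by blast
      moreover have "open ?N" using \<open>open H\<close> \<open>finite C\<close> by (intro open_Diff closed_UN) auto
      moreover have "continuous_on (S \<inter> ?N) g" using g_cont by (rule continuous_on_subset) blast
      moreover have "G y = g y" if "y \<in> S \<inter> ?N" for y
        using that closure_subset by (intro G_g) blast
      ultimately show ?thesis by blast
    qed
  qed
  then show ?thesis
    using logarithm_iff_not_separated [OF \<open>compact S\<close>, of a b] G_exp ab \<open>S \<subseteq> H \<union> C\<close>
    unfolding f_def by blast
qed

text \<open>By Borsuk's criterion a separating compact set obstructs the logarithm of \<open>(z
  - a) / (z - b)\<close>, so by the preceding lemma some closed path in \<open>H \<union>
  C\<close> changes its value, and such a path contains the curve. Removing \<open>C\<close>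
  from \<open>H\<close> changes neither the union nor openness.\<close>

lemma separating_compact_set_imp_separating_curve:
  fixes a b :: complex
  assumes "open H" "finite C" "compact S" "S \<subseteq> H \<union> C"
    and ab: "a \<notin> H \<union> C" "b \<notin> H \<union> C" and sep: "\<not> connected_component (- S) a b"
  obtains \<gamma> where "simple_closed_curve \<gamma>" "curve_separates \<gamma> a b" "\<gamma> \<subseteq> H \<union> C"
proof (rule ccontr)
  note found = that
  assume no: "\<not> thesis"
  have "a \<in> - S" using assms by blast
  then have "a \<noteq> b" using sep connected_component_refl by metis
  have "connected_component (- S) a b"
  proof (rule univalent_log_cover_imp_not_separated [of "H - C" C])
    show "open (H - C)" using assms by (intro open_Diff finite_imp_closed)
    show "w = w'" if pc: "path_component (log_cover (H - C \<union> C) a b) (z, w) (z, w')" for z w w'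
    proof (rule ccontr)
      assume "w \<noteq> w'"
      then obtain \<gamma> where "simple_closed_curve \<gamma>" "curve_separates \<gamma> a b" "\<gamma> \<subseteq> H - C \<union> C"
        using nontrivial_log_cover_path_imp_separating_curve [OF \<open>a \<noteq> b\<close> pc \<open>w \<noteq> w'\<close>] by metis
      then have thesis by (intro found) auto
      then show False using no by contradiction
    qed
  qed (use assms \<open>a \<noteq> b\<close> in auto)
  then show False using sep by blast
qed

section \<open>Finite separators of a compact plane set\<close>

text \<open>Take the frontier of the set of points that lie closer to \<open>A \<union>
  C\<close> than to \<open>B \<union> C\<close>, cut down to a large ball. Its points in the
  ball are equally far from both sets; such a point of \<open>K\<close> has distance zero from
  both of these closed sets, so it lies in their intersection \<open>C\<close>.\<close>

lemma separated_imp_compact_separator: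
  fixes K :: "complex set"
  assumes "compact K" "finite C" "C \<subseteq> K" and AB: "K - C = A \<union> B"
    and cl: "closure A \<inter> B = {}" "A \<inter> closure B = {}" and xy: "x \<in> A" "y \<in> B"
  obtains S where "compact S" "S \<subseteq> - K \<union> C" "\<not> connected_component (- S) x y"
proof -
  have "closed K" using \<open>compact K\<close> by (rule compact_imp_closed)
  have "closure A \<subseteq> K" "closure B \<subseteq> K"
    by (rule closure_minimal [OF _ \<open>closed K\<close>], use AB in blast)+
  then have "closure A \<subseteq> A \<union> C" "closure B \<subseteq> B \<union> C" using AB cl by blast+
  then have clo: "closed (A \<union> C)" "closed (B \<union> C)"
    using finite_imp_closed [OF \<open>finite C\<close>] by (metis closure_Un closure_closed closure_subset_eq Un_least Un_upper2)+
  have "A \<inter> B = {}" using cl closure_subset by blast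
  then have MN: "(A \<union> C) \<inter> (B \<union> C) = C" "A \<inter> C = {}" "B \<inter> C = {}" using AB by blast+
  obtain R where R: "K \<subseteq> ball 0 R"
    using \<open>compact K\<close> compact_imp_bounded bounded_subset_ballD by metis
  define \<phi> where "\<phi> z = infdist z (A \<union> C) - infdist z (B \<union> C)" for z
  have \<phi>_cont: "continuous_on U \<phi>" for U unfolding \<phi>_def by (intro continuous_intros)
  have ne: "A \<union> C \<noteq> {}" "B \<union> C \<noteq> {}" using xy by auto
  have zero: "infdist z (A \<union> C) = 0 \<longleftrightarrow> z \<in> A \<union> C" "infdist z (B \<union> C) = 0 \<longleftrightarrow> z \<in> B \<union> C" for z
    using in_closed_iff_infdist_zero clo ne by blast+
  define W where "W = {z. \<phi> z < 0} \<inter> ball 0 R"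
  have "open W"
    unfolding W_def by (intro open_Int open_ball open_Collect_less \<phi>_cont continuous_on_const)
  have "closure W \<subseteq> {z. \<phi> z \<le> 0} \<inter> cball 0 R"
    by (rule closure_minimal)
      (auto simp: W_def intro!: closed_Int closed_Collect_le \<phi>_cont continuous_on_const)
  then have fr: "\<phi> z \<le> 0 \<and> z \<notin> W" if "z \<in> frontier W" for z
    using that \<open>open W\<close> by (auto simp: frontier_def interior_open)
  have "K \<inter> frontier W \<subseteq> C"
  proof
    fix z assume z: "z \<in> K \<inter> frontier W"
    then have "\<phi> z = 0" using fr [of z] R unfolding W_def by force
    moreover have "z \<in> A \<union> C \<or> z \<in> B \<union> C" using z AB by blast
    ultimately have "z \<in> (A \<union> C) \<inter> (B \<union> C)" using zero [of z] unfolding \<phi>_def by force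
    then show "z \<in> C" using MN by simp
  qed
  moreover have "compact (frontier W)"
    unfolding W_def by (intro compact_frontier_bounded bounded_Int) simp
  moreover have "\<not> connected_component (- frontier W) x y"
  proof
    assume "connected_component (- frontier W) x y"
    then obtain D where D: "connected D" "D \<subseteq> - frontier W" "x \<in> D" "y \<in> D"
      by (auto simp: connected_component_def)
    have "0 \<le> infdist x (B \<union> C)" "infdist x (B \<union> C) \<noteq> 0" "infdist x (A \<union> C) = 0"
      unfolding zero using xy MN \<open>A \<inter> B = {}\<close> by (auto simp: infdist_nonneg)
    then have "\<phi> x < 0" unfolding \<phi>_def by simp
    moreover have "x \<in> K" using xy AB by blast
    ultimately have "x \<in> W" unfolding W_def using R by blast
    moreover have "infdist y (B \<union> C) = 0" unfolding zero using xy by simp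
    then have "0 \<le> \<phi> y" unfolding \<phi>_def by (simp add: infdist_nonneg)
    then have "y \<notin> W" unfolding W_def by auto
    ultimately show False using connected_Int_frontier [OF D(1), of W] D by blast
  qed
  ultimately show thesis using that by blast
qed

section \<open>Connectedness of the pseudo-fibers\<close>

text \<open>Call a relatively open part of the boundary containing \<open>x\<close> thin if its
  relative frontier is finite. A point is separated from \<open>x\<close> by a finite set
  exactly if it lies outside the closure of some thin set, so the pseudo-fiber \<open>E\<close>
  is closed. Suppose that it were the union of disjoint nonempty closed sets \<open>P\<close>
  and \<open>Q\<close> with \<open>x\<close> in \<open>P\<close>, and enclose \<open>P\<close>
  in an open set \<open>W\<close> whose closure misses \<open>Q\<close>. The part of the
  boundary of \<open>X\<close> on the frontier of \<open>W\<close> is compact and misses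
  \<open>E\<close>, so finitely many thin sets suffice to exclude all of it from their closures.
  Intersecting them with \<open>W\<close> gives a thin set, whose closure misses
  \<open>Q\<close>, although \<open>Q\<close> is contained in \<open>E\<close>.\<close>

lemma connected_modified_pseudo_fiber:
  assumes "compact X" "x \<in> X" "x \<notin> interior X"
  shows "connected (modified_pseudo_fiber X x)"
proof -
  let ?K = "frontier X"
  define E where "E = modified_pseudo_fiber X x"
  have E: "y \<in> E \<longleftrightarrow> y \<in> ?K \<and> \<not> (\<exists>C. finite C \<and> C \<subseteq> ?K \<and> separated_by X C x y)" for y
    using assms by (simp add: E_def modified_pseudo_fiber_def)
  have "compact ?K" using \<open>compact X\<close> by (rule compact_frontier)
  then have "closed ?K" by (rule compact_imp_closed)
  have "x \<in> ?K" using assms(2,3) closure_subset by (auto simp: frontier_def)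
  have "\<not> separated_by X C x x" for C
    unfolding separated_by_def using closure_subset by (metis IntI empty_iff subsetD)
  then have "x \<in> E" using \<open>x \<in> ?K\<close> E [of x] by simp
  define thin where "thin U \<longleftrightarrow> openin (top_of_set ?K) U \<and> x \<in> U \<and> finite (?K \<inter> closure U - U)" for U
  have thin_outside: "\<exists>U. thin U \<and> y \<notin> closure U" if y: "y \<in> ?K" "y \<notin> E" for y
  proof -
    obtain C where C: "finite C" "separated_by X C x y" using y E [of y] by auto
    then obtain A B where AB: "?K - C = A \<union> B" "closure A \<inter> B = {}"
        "A \<inter> closure B = {}" "x \<in> A" "y \<in> B"
      unfolding separated_by_def by blast
    have "open (- (closure B \<union> C))" using C(1) finite_imp_closed by blast
    moreover have "A = ?K \<inter> - (closure B \<union> C)"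
      using AB(1,3) closure_subset [of B] by blast
    ultimately have "openin (top_of_set ?K) A"
      using openin_open_Int by metis
    moreover have "?K \<inter> closure A - A \<subseteq> C" using AB(1,2) by blast
    then have "finite (?K \<inter> closure A - A)" using C(1) finite_subset by blast
    ultimately have "thin A" using AB(4) unfolding thin_def by blast
    then show ?thesis using AB(2,5) by blast
  qed
  have outside_thin: "y \<notin> E" if U: "thin U" "y \<in> ?K" "y \<notin> closure U" for U y
  proof -
    let ?C = "?K \<inter> closure U - U"
    obtain G where G: "open G" "U = ?K \<inter> G" using U(1) unfolding thin_def by (metis openin_open)
    have "separated_by X ?C x y" unfolding separated_by_def
    proof (intro exI conjI)
      show "?K - ?C = U \<union> (?K - closure U)"
        using G(2) closure_subset [of U] by blast
      have "G \<inter> closure (?K - closure U) = {}"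
        unfolding open_Int_closure_eq_empty [OF G(1)] using G(2) closure_subset [of U] by blast
      then show "U \<inter> closure (?K - closure U) = {}" using G(2) by blast
    qed (use U in \<open>auto simp: thin_def\<close>)
    moreover have "finite ?C" using U(1) unfolding thin_def by simp
    moreover have "?C \<subseteq> ?K" by blast
    ultimately show ?thesis using E [of y] by blast
  qed
  have "E = ?K \<inter> \<Inter>(closure ` Collect thin)"
  proof (intro set_eqI iffI)
    fix y assume "y \<in> E"
    then show "y \<in> ?K \<inter> \<Inter>(closure ` Collect thin)" using E [of y] outside_thin [of _ y] by auto
  next
    fix y assume "y \<in> ?K \<inter> \<Inter>(closure ` Collect thin)"
    then show "y \<in> E" using thin_outside [of y] by auto
  qed
  then have "closed E" using \<open>closed ?K\<close> by (auto intro!: closed_Int closed_INT)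
  have "connected E"
  proof (rule ccontr)
    assume "\<not> connected E"
    then obtain P0 Q0 where "closed P0" "closed Q0" "P0 \<union> Q0 = E" "P0 \<inter> Q0 = {}" "P0 \<noteq> {}" "Q0 \<noteq> {}"
      unfolding connected_closed_set [OF \<open>closed E\<close>] by blast
    then obtain P Q where PQ: "closed P" "closed Q" "P \<union> Q = E" "P \<inter> Q = {}" "x \<in> P" "Q \<noteq> {}"
      using \<open>x \<in> E\<close> by (cases "x \<in> P0") blast+
    then obtain y where "y \<in> Q" by blast
    then have "y \<in> E" using PQ(3) by blast
    then have "y \<in> ?K" using E [of y] by simp
    obtain W W' where W: "open W" "open W'" "P \<subseteq> W" "Q \<subseteq> W'" "W \<inter> W' = {}"
      using separation_normal [OF PQ(1,2,4)] by blast
    have clW: "closure W \<inter> W' = {}"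
      using W(5) open_Int_closure_eq_empty [OF W(2), of W] by blast
    have frW: "frontier W = closure W - W" using W(1) by (simp add: frontier_def interior_open)
    have "?K \<inter> frontier W \<subseteq> \<Union>((\<lambda>U. - closure U) ` Collect thin)"
    proof
      fix z assume z: "z \<in> ?K \<inter> frontier W"
      then have "z \<notin> E" using frW clW W(3,4) PQ(3) by blast
      then show "z \<in> \<Union>((\<lambda>U. - closure U) ` Collect thin)" using z thin_outside [of z] by auto
    qed
    moreover have "compact (?K \<inter> frontier W)"
      using \<open>compact ?K\<close> by (intro compact_Int_closed) auto
    ultimately obtain F where F: "F \<subseteq> Collect thin" "finite F"
        "?K \<inter> frontier W \<subseteq> (\<Union>U\<in>F. - closure U)"
      by (elim compactE_image [where C = "Collect thin" and f = "\<lambda>U. - closure U"]) auto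
    define U where "U = \<Inter>(insert (?K \<inter> W) F)"
    have thinF: "thin A" if "A \<in> F" for A using F(1) that by blast
    have "openin (top_of_set ?K) U"
      unfolding U_def using F(2) thinF W(1)
      by (intro openin_Inter) (auto simp: thin_def openin_open_Int)
    moreover have "x \<in> U" using \<open>x \<in> ?K\<close> PQ(5) W(3) thinF unfolding U_def thin_def by blast
    moreover have clU: "closure U \<subseteq> closure W" "\<And>A. A \<in> F \<Longrightarrow> closure U \<subseteq> closure A"
      unfolding U_def by (auto intro!: closure_mono)
    \<comment> \<open>Passing to \<open>W\<close> creates no new frontier points: on the frontier of \<open>W\<close> some
      member of \<open>F\<close> is out of reach.\<close>
    have "?K \<inter> closure U - U \<subseteq> (\<Union>A\<in>F. ?K \<inter> closure A - A)"
    proof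
      fix z assume z: "z \<in> ?K \<inter> closure U - U"
      then have "z \<notin> frontier W" using F(3) clU(2) by blast
      then have "z \<in> W" using z clU(1) frW by blast
      then show "z \<in> (\<Union>A\<in>F. ?K \<inter> closure A - A)"
        using z clU(2) unfolding U_def by blast
    qed
    moreover have "finite (\<Union>A\<in>F. ?K \<inter> closure A - A)" using F(2) thinF unfolding thin_def by blast
    ultimately have "thin U" using finite_subset unfolding thin_def by blast
    moreover have "y \<notin> closure U" using \<open>y \<in> Q\<close> W(4) clW clU(1) by blast
    ultimately show False using outside_thin \<open>y \<in> E\<close> \<open>y \<in> ?K\<close> by blast
  qed
  then show ?thesis by (simp add: E_def)
qed

section \<open>Fibers and separating curves\<close>

lemma separated_by_imp_separating_curve:
  assumes "compact X" "finite C" "C \<subseteq> frontier X" "separated_by X C x y"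
  obtains \<gamma> where "simple_closed_curve \<gamma>" "curve_separates \<gamma> x y" "\<gamma> \<inter> frontier X \<subseteq> C"
proof -
  obtain A B where AB: "frontier X - C = A \<union> B" "closure A \<inter> B = {}" "A \<inter> closure B = {}" "x \<in> A" "y \<in> B"
    using assms(4) unfolding separated_by_def by blast
  have "compact (frontier X)" using \<open>compact X\<close> by (rule compact_frontier)
  then obtain S where S: "compact S" "S \<subseteq> - frontier X \<union> C" "\<not> connected_component (- S) x y"
    using separated_imp_compact_separator [OF _ assms(2,3) AB] by metis
  have "open (- frontier X)" by (simp add: frontier_closed open_Compl)
  moreover have "x \<notin> - frontier X \<union> C" "y \<notin> - frontier X \<union> C" using AB(1,4,5) by blast+
  ultimately obtain \<gamma> where "simple_closed_curve \<gamma>" "curve_separates \<gamma> x y" "\<gamma> \<subseteq> - frontier X \<union> C"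
    using separating_compact_set_imp_separating_curve [OF _ assms(2) S(1,2) _ _ S(3)] by metis
  then show thesis using that by blast
qed

text \<open>The component of the complement of the curve that contains \<open>x\<close>, and the
  union of the other components, are disjoint open sets; they cut the boundary outside the curve
  into two separated parts.\<close>

lemma separating_curve_imp_separated_by:
  assumes "curve_separates \<gamma> x y" "closed \<gamma>" "x \<in> frontier X" "y \<in> frontier X"
  shows "separated_by X (\<gamma> \<inter> frontier X) x y"
proof -
  obtain U V where UV: "U \<in> components (- \<gamma>)" "V \<in> components (- \<gamma>)" "U \<noteq> V" "x \<in> U" "y \<in> V"
    using assms(1) unfolding curve_separates_def by blast
  have "open (- \<gamma>)" using \<open>closed \<gamma>\<close> by (rule open_Compl)
  define U' where "U' = \<Union>(components (- \<gamma>) - {U})"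
  have "open U" "open U'"
    unfolding U'_def using UV(1) open_components [OF \<open>open (- \<gamma>)\<close>] by (auto intro: open_Union)
  have "U \<inter> U' = {}" unfolding U'_def using components_nonoverlap UV(1) by blast
  have "U \<union> U' = - \<gamma>" unfolding U'_def using UV(1) Union_components [of "- \<gamma>"] by blast
  have "y \<in> U'" unfolding U'_def using UV by blast
  have "closure (frontier X \<inter> U) \<inter> U' = {}" "U \<inter> closure (frontier X \<inter> U') = {}"
    using \<open>U \<inter> U' = {}\<close> open_Int_closure_eq_empty [OF \<open>open U'\<close>, of "frontier X \<inter> U"]
      open_Int_closure_eq_empty [OF \<open>open U\<close>, of "frontier X \<inter> U'"] by blast+
  moreover have "frontier X - \<gamma> \<inter> frontier X = (frontier X \<inter> U) \<union> (frontier X \<inter> U')"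
    using \<open>U \<union> U' = - \<gamma>\<close> by blast
  moreover have "closure (frontier X \<inter> U) \<inter> (frontier X \<inter> U') = {}"
      "(frontier X \<inter> U) \<inter> closure (frontier X \<inter> U') = {}"
    using calculation by blast+
  ultimately show ?thesis
    unfolding separated_by_def using \<open>y \<in> U'\<close> UV(4) assms(3,4)
    by (intro exI [of _ "frontier X \<inter> U"] exI [of _ "frontier X \<inter> U'"] conjI IntI)
qed

lemma simple_closed_curve_imp_closed:
  "simple_closed_curve \<gamma> \<Longrightarrow> closed \<gamma>"
  unfolding simple_closed_curve_def
  using closed_path_image simple_path_imp_path by blast

lemma curve_separates_sym: "curve_separates \<gamma> x y \<Longrightarrow> curve_separates \<gamma> y x"
  unfolding curve_separates_def by metis

lemma interior_point_separating_curve: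
  assumes "x \<in> interior X" "y \<noteq> x"
  obtains \<gamma> where "simple_closed_curve \<gamma>" "curve_separates \<gamma> x y" "\<gamma> \<inter> frontier X = {}"
proof -
  obtain e where e: "0 < e" "ball x e \<subseteq> interior X"
    using assms(1) open_interior openE by blast
  define d where "d = min (e / 2) (dist x y / 2)"
  have "0 < dist x y" using assms(2) by simp
  then have d: "0 < d" "d < e" "d < dist x y" using e(1) by (auto simp: d_def min_less_iff_disj)
  let ?\<gamma> = "sphere x d"
  have "path_image (circlepath x d) = ?\<gamma>" using d by simp
  then have "simple_closed_curve ?\<gamma>"
    unfolding simple_closed_curve_def using d
    by (intro exI [of _ "circlepath x d"]) (auto simp: simple_path_circlepath)
  moreover have "?\<gamma> \<subseteq> interior X" using e(2) d(2) by force
  then have "?\<gamma> \<inter> frontier X = {}" by (auto simp: frontier_def)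
  moreover have "\<not> connected_component (- ?\<gamma>) x y"
  proof
    assume "connected_component (- ?\<gamma>) x y"
    then obtain D where D: "connected D" "D \<subseteq> - ?\<gamma>" "x \<in> D" "y \<in> D"
      by (auto simp: connected_component_def)
    have "frontier (ball x d) = ?\<gamma>" using d(1) by (simp add: frontier_ball)
    moreover have "x \<in> ball x d" "y \<notin> ball x d" using d by auto
    ultimately show False using connected_Int_frontier [OF D(1), of "ball x d"] D(2,3,4) by blast
  qed
  then have "curve_separates ?\<gamma> x y" using d by (intro curve_separatesI) auto
  ultimately show thesis using that by blast
qed

text \<open>For a boundary point \<open>x\<close> the fiber is the whole pseudo-fiber, since
  this is connected. Points of the interior are handled by small circles, which do not meet the
  boundary.\<close>

lemma not_in_modified_fiber_iff_separating_curve: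
  assumes "compact X" "x \<in> X" "y \<in> X"
  shows "y \<notin> modified_fiber X x \<longleftrightarrow>
    (\<exists>\<gamma>. simple_closed_curve \<gamma> \<and> curve_separates \<gamma> x y \<and> finite (\<gamma> \<inter> frontier X))"
    (is "_ \<longleftrightarrow> ?curve")
proof -
  have not_self: "\<not> curve_separates \<gamma> z z" for \<gamma> z
    unfolding curve_separates_def using components_nonoverlap by blast
  show ?thesis
  proof (cases "x \<in> interior X")
    case True
    then have "modified_fiber X x = {x}"
      using connected_component_eq_self [of "{x}" x]
      by (simp add: modified_fiber_def modified_pseudo_fiber_def)
    moreover have "?curve" if "y \<noteq> x"
      using interior_point_separating_curve [OF True that] by (metis finite.emptyI)
    ultimately show ?thesis using not_self by auto
  next
    case False
    then have x: "x \<in> frontier X" using assms(2) closure_subset by (auto simp: frontier_def)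
    have "x \<in> modified_pseudo_fiber X x"
      using x False closure_subset by (auto simp: modified_pseudo_fiber_def separated_by_def)
    then have "modified_fiber X x = modified_pseudo_fiber X x"
      unfolding modified_fiber_def
      using connected_modified_pseudo_fiber [OF assms(1,2) False]
      by (metis connected_component_eq_self)
    then have fiber: "y \<notin> modified_fiber X x \<longleftrightarrow>
        y \<in> interior X \<or> (\<exists>C. finite C \<and> C \<subseteq> frontier X \<and> separated_by X C x y)"
      using False assms(3) closure_subset [of X] by (auto simp: modified_pseudo_fiber_def frontier_def)
    show ?thesis
    proof
      assume "y \<notin> modified_fiber X x"
      then consider "y \<in> interior X" | C where "finite C" "C \<subseteq> frontier X" "separated_by X C x y"
        using fiber by blast
      then show ?curve
      proof cases
        case 1
        then have "x \<noteq> y" using False by blast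
        then show ?thesis
          using interior_point_separating_curve [OF 1] curve_separates_sym by (metis finite.emptyI)
      next
        case 2
        then show ?thesis
          using separated_by_imp_separating_curve [OF assms(1)] by (metis finite_subset)
      qed
    next
      assume ?curve
      then obtain \<gamma> where \<gamma>: "simple_closed_curve \<gamma>" "curve_separates \<gamma> x y" "finite (\<gamma> \<inter> frontier X)"
        by blast
      show "y \<notin> modified_fiber X x"
      proof (cases "y \<in> interior X")
        case False
        then have "y \<in> frontier X" using assms(3) closure_subset by (auto simp: frontier_def)
        then have "separated_by X (\<gamma> \<inter> frontier X) x y"
          using separating_curve_imp_separated_by \<gamma>(1,2) x simple_closed_curve_imp_closed by blast
        then show ?thesis using fiber \<gamma>(3) by blast
      qed (use fiber in blast)
    qed
  qed
qed

theorem theorem2: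
  fixes X :: "complex set" and x :: complex
  assumes "plane_continuum X" and "x \<in> X"
  shows "modified_fiber X x =
           {y \<in> X. \<forall>\<gamma>. simple_closed_curve \<gamma> \<and> curve_separates \<gamma> x y
                      \<longrightarrow> infinite (\<gamma> \<inter> frontier X)}
       \<and> X - modified_fiber X x =
           {z \<in> X. \<exists>\<gamma>. simple_closed_curve \<gamma> \<and> curve_separates \<gamma> x z
                      \<and> finite (\<gamma> \<inter> frontier X)}"
proof -
  have "compact X" using assms(1) by (simp add: plane_continuum_def)
  have "modified_pseudo_fiber X x \<subseteq> X"
    using \<open>x \<in> X\<close> frontier_subset_closed [OF compact_imp_closed [OF \<open>compact X\<close>]]
    by (auto simp: modified_pseudo_fiber_def)
  then have "modified_fiber X x \<subseteq> X"
    unfolding modified_fiber_def using connected_component_subset by blast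
  then show ?thesis
    using not_in_modified_fiber_iff_separating_curve [OF \<open>compact X\<close> \<open>x \<in> X\<close>] by blast
qed

end
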